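(* Let $u\colon\mathbb{R}^3\to\mathbb{C}$, let $U$ be its classical (complex) Fourier transform and $U_{\mathrm{OFT}}$ its octonion Fourier transform. Then for all $(f_1,f_2,f_3)\in\mathbb{R}^3$ $$\begin{aligned}U_{\mathrm{OFT}}(f_1,f_2,f_3)&=\tfrac14\big(U(f_1,f_2,f_3)\cdot(1-\mathbf{e}_3)+U(f_1,-f_2,f_3)\cdot(1+\mathbf{e}_3)\big)\cdot(1-\mathbf{e}_5)\\&\quad+\tfrac14\big(U(f_1,f_2,-f_3)\cdot(1-\mathbf{e}_3)+U(f_1,-f_2,-f_3)\cdot(1+\mathbf{e}_3)\big)\cdot(1+\mathbf{e}_5),\end{aligned}$$ where octonion multiplication is done from left to right.
   Context: $\mathbb{O}$ denotes the real algebra of octonions with basis $1,\mathbf{e}_1,\dots,\mathbf{e}_7$: an octonion is a pair $(q_0,q_1)$ of quaternions (quaternion units $\mathbf{e}_1,\mathbf{e}_2,\mathbf{e}_3$ with $\mathbf{e}_1\mathbf{e}_2=\mathbf{e}_3$), with product $(q_0,q_1)\cdot(p_0,p_1)=(q_0p_0-p_1^*q_1,\;p_1q_0+q_1p_0^* )$, where $^*$ is quaternion conjugation, and $\mathbf{e}_4=(0,1)$, $\mathbf{e}_5=(0,\mathbf{e}_1)$, $\mathbf{e}_6=(0,\mathbf{e}_2)$, $\mathbf{e}_7=(0,\mathbf{e}_3)$. The product is neither commutative nor associative; products without brackets are evaluated from left to right, i.e. $abcd=((ab)c)d$. For an imaginary unit $\mathbf{e}_k$ and $\alpha\in\mathbb{R}$,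 $e^{\mathbf{e}_k\alpha}=\cos\alpha+\mathbf{e}_k\sin\alpha$. Integrals of octonion-valued functions are taken componentwise. The octonion Fourier transform (OFT) of a Lebesgue integrable $u\colon\mathbb{R}^3\to\mathbb{O}$ is $$U_{\mathrm{OFT}}(\mathbf{f})=\int_{\mathbb{R}^3}u(\mathbf{x})\,e^{-\mathbf{e}_1 2\pi f_1x_1}\,e^{-\mathbf{e}_2 2\pi f_2x_2}\,e^{-\mathbf{e}_4 2\pi f_3x_3}\,d\mathbf{x},\qquad \mathbf{f}=(f_1,f_2,f_3)\in\mathbb{R}^3,$$ with multiplication from left to right. Here $\mathbb{C}$ is identified with the subfield $\{a+b\mathbf{e}_1: a,b\in\mathbb{R}\}$ of $\mathbb{O}$, and the classical Fourier transform of $u\colon\mathbb{R}^3\to\mathbb{C}$ is $U(\mathbf{f})=\int_{\mathbb{R}^3}u(\mathbf{x})\,e^{-\mathbf{e}_1 2\pi(f_1x_1+f_2x_2+f_3x_3)}\,d\mathbf{x}$. Standing assumption: the function $u$ is Lebesgue integrable, so that its transforms are well defined. *)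

theory Defs
  imports "HOL-Analysis.Analysis"
begin

section \<open>Quaternions\<close>

codatatype quat = Quat (qre: real) (qim1: real) (qim2: real) (qim3: real)

instantiation quat :: real_algebra_1
begin

primcorec zero_quat where
  "qre 0 = 0" | "qim1 0 = 0" | "qim2 0 = 0" | "qim3 0 = 0"

primcorec one_quat where
  "qre 1 = 1" | "qim1 1 = 0" | "qim2 1 = 0" | "qim3 1 = 0"

primcorec plus_quat where
  "qre (p + q) = qre p + qre q"
| "qim1 (p + q) = qim1 p + qim1 q"
| "qim2 (p + q) = qim2 p + qim2 q"
| "qim3 (p + q) = qim3 p + qim3 q"

primcorec uminus_quat where
  "qre (- q) = - qre q"
| "qim1 (- q) = - qim1 q"
| "qim2 (- q) = - qim2 q"
| "qim3 (- q) = - qim3 q"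

primcorec minus_quat where
  "qre (p - q) = qre p - qre q"
| "qim1 (p - q) = qim1 p - qim1 q"
| "qim2 (p - q) = qim2 p - qim2 q"
| "qim3 (p - q) = qim3 p - qim3 q"

primcorec scaleR_quat where
  "qre (r *\<^sub>R q) = r * qre q"
| "qim1 (r *\<^sub>R q) = r * qim1 q"
| "qim2 (r *\<^sub>R q) = r * qim2 q"
| "qim3 (r *\<^sub>R q) = r * qim3 q"

primcorec times_quat where
  "qre (p * q) = qre p * qre q - qim1 p * qim1 q - qim2 p * qim2 q - qim3 p * qim3 q"
| "qim1 (p * q) = qre p * qim1 q + qim1 p * qre q + qim2 p * qim3 q - qim3 p * qim2 q"
| "qim2 (p * q) = qre p * qim2 q - qim1 p * qim3 q + qim2 p * qre q + qim3 p * qim1 q"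
| "qim3 (p * q) = qre p * qim3 q + qim1 p * qim2 q - qim2 p * qim1 q + qim3 p * qre q"

instance
  by standard (auto simp: algebra_simps intro!: quat.expand dest: arg_cong[of _ _ qre])

end

primcorec qcnj :: "quat \<Rightarrow> quat" where
  "qre (qcnj q) = qre q"
| "qim1 (qcnj q) = - qim1 q"
| "qim2 (qcnj q) = - qim2 q"
| "qim3 (qcnj q) = - qim3 q"

definition \<q>\<^sub>1 :: quat where "\<q>\<^sub>1 = Quat 0 1 0 0"
definition \<q>\<^sub>2 :: quat where "\<q>\<^sub>2 = Quat 0 0 1 0"
definition \<q>\<^sub>3 :: quat where "\<q>\<^sub>3 = Quat 0 0 0 1"

lemmas quat_unit_defs = \<q>\<^sub>1_def \<q>\<^sub>2_def \<q>\<^sub>3_def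

lemma quat_unit_products:
  "\<q>\<^sub>1 * \<q>\<^sub>1 = -1" "\<q>\<^sub>2 * \<q>\<^sub>2 = -1" "\<q>\<^sub>3 * \<q>\<^sub>3 = -1"
  "\<q>\<^sub>1 * \<q>\<^sub>2 = \<q>\<^sub>3" "\<q>\<^sub>2 * \<q>\<^sub>3 = \<q>\<^sub>1" "\<q>\<^sub>3 * \<q>\<^sub>1 = \<q>\<^sub>2"
  "\<q>\<^sub>2 * \<q>\<^sub>1 = - \<q>\<^sub>3" "\<q>\<^sub>3 * \<q>\<^sub>2 = - \<q>\<^sub>1" "\<q>\<^sub>1 * \<q>\<^sub>3 = - \<q>\<^sub>2"
  by (auto intro!: quat.expand simp: quat_unit_defs)


section \<open>Octonions\<close>

codatatype octonion = Octonion (oct_fst: quat) (oct_snd: quat)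

text \<open>
  Octonion multiplication is not associative, so the ring type classes do not apply to it;
  the type only gets the vector space structure together with a bare product and unit.
  As the infix product associates to the left, an unbracketed product is read
  from left to right.
\<close>

instantiation octonion :: real_vector
begin

primcorec zero_octonion where
  "oct_fst 0 = 0" | "oct_snd 0 = 0"

primcorec plus_octonion where
  "oct_fst (a + b) = oct_fst a + oct_fst b"
| "oct_snd (a + b) = oct_snd a + oct_snd b"

primcorec uminus_octonion where
  "oct_fst (- a) = - oct_fst a"
| "oct_snd (- a) = - oct_snd a"

primcorec minus_octonion where
  "oct_fst (a - b) = oct_fst a - oct_fst b"
| "oct_snd (a - b) = oct_snd a - oct_snd b"

primcorec scaleR_octonion where
  "oct_fst (r *\<^sub>R a) = r *\<^sub>R oct_fst a"
| "oct_snd (r *\<^sub>R a) = r *\<^sub>R oct_snd a"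

instance
  by standard (auto intro!: octonion.expand simp: algebra_simps)

end

instantiation octonion :: "{times, one}"
begin

primcorec one_octonion where
  "oct_fst 1 = 1" | "oct_snd 1 = 0"

primcorec times_octonion where
  "oct_fst (a * b) = oct_fst a * oct_fst b - qcnj (oct_snd b) * oct_snd a"
| "oct_snd (a * b) = oct_snd b * oct_fst a + oct_snd a * qcnj (oct_fst b)"

instance ..

end

definition \<e>\<^sub>1 :: octonion where "\<e>\<^sub>1 = Octonion \<q>\<^sub>1 0"
definition \<e>\<^sub>2 :: octonion where "\<e>\<^sub>2 = Octonion \<q>\<^sub>2 0"
definition \<e>\<^sub>3 :: octonion where "\<e>\<^sub>3 = Octonion \<q>\<^sub>3 0"
definition \<e>\<^sub>4 :: octonion where "\<e>\<^sub>4 = Octonion 0 1"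
definition \<e>\<^sub>5 :: octonion where "\<e>\<^sub>5 = Octonion 0 \<q>\<^sub>1"
definition \<e>\<^sub>6 :: octonion where "\<e>\<^sub>6 = Octonion 0 \<q>\<^sub>2"
definition \<e>\<^sub>7 :: octonion where "\<e>\<^sub>7 = Octonion 0 \<q>\<^sub>3"

lemmas octonion_unit_defs =
  \<e>\<^sub>1_def \<e>\<^sub>2_def \<e>\<^sub>3_def \<e>\<^sub>4_def \<e>\<^sub>5_def \<e>\<^sub>6_def \<e>\<^sub>7_def

lemma octonion_unit_products:
  "\<e>\<^sub>1 * \<e>\<^sub>2 = \<e>\<^sub>3" "\<e>\<^sub>1 * \<e>\<^sub>4 = \<e>\<^sub>5" "\<e>\<^sub>2 * \<e>\<^sub>4 = \<e>\<^sub>6" "\<e>\<^sub>3 * \<e>\<^sub>4 = \<e>\<^sub>7"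
  "\<e>\<^sub>4 * \<e>\<^sub>1 = - \<e>\<^sub>5" "\<e>\<^sub>4 * \<e>\<^sub>4 = -1"
  "\<e>\<^sub>1 * \<e>\<^sub>2 * \<e>\<^sub>4 = \<e>\<^sub>7" "\<e>\<^sub>1 * (\<e>\<^sub>2 * \<e>\<^sub>4) = - \<e>\<^sub>7"
  by (auto intro!: octonion.expand quat.expand simp: octonion_unit_defs quat_unit_defs)

text \<open>
  The exponential of \<open>e\<close> times \<open>\<alpha>\<close>, for an imaginary unit \<open>e\<close> and a real \<open>\<alpha>\<close>.
\<close>

definition octexp :: "octonion \<Rightarrow> real \<Rightarrow> octonion" where
  "octexp e \<alpha> = cos \<alpha> *\<^sub>R 1 + sin \<alpha> *\<^sub>R e"

definition oct_of_complex :: "complex \<Rightarrow> octonion" where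
  "oct_of_complex z = Re z *\<^sub>R 1 + Im z *\<^sub>R \<e>\<^sub>1"

lemma oct_of_complex_hom:
  "oct_of_complex 0 = 0" "oct_of_complex 1 = 1" "oct_of_complex \<i> = \<e>\<^sub>1"
  "oct_of_complex (z + w) = oct_of_complex z + oct_of_complex w"
  "oct_of_complex (z * w) = oct_of_complex z * oct_of_complex w"
  "oct_of_complex (exp (\<i> * complex_of_real \<alpha>)) = octexp \<e>\<^sub>1 \<alpha>"
  by (auto intro!: octonion.expand quat.expand
      simp: oct_of_complex_def octexp_def \<e>\<^sub>1_def \<q>\<^sub>1_def algebra_simps Re_exp Im_exp)


section \<open>Integrals and Fourier transforms\<close>

definition quat_integral :: "'a measure \<Rightarrow> ('a \<Rightarrow> quat) \<Rightarrow> quat" where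
  "quat_integral M g =
     Quat (LINT x|M. qre (g x)) (LINT x|M. qim1 (g x))
          (LINT x|M. qim2 (g x)) (LINT x|M. qim3 (g x))"

definition oct_integral :: "'a measure \<Rightarrow> ('a \<Rightarrow> octonion) \<Rightarrow> octonion" where
  "oct_integral M g =
     Octonion (quat_integral M (\<lambda>x. oct_fst (g x))) (quat_integral M (\<lambda>x. oct_snd (g x)))"

definition fourier :: "(real^3 \<Rightarrow> complex) \<Rightarrow> real^3 \<Rightarrow> complex" where
  "fourier u f =
     (LINT x|lebesgue. u x *
        exp (- \<i> * complex_of_real (2 * pi * (f $ 1 * x $ 1 + f $ 2 * x $ 2 + f $ 3 * x $ 3))))"

definition oct_fourier :: "(real^3 \<Rightarrow> octonion) \<Rightarrow> real^3 \<Rightarrow> octonion" where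
  "oct_fourier u f =
     oct_integral lebesgue (\<lambda>x. u x * octexp \<e>\<^sub>1 (- 2 * pi * f $ 1 * x $ 1)
                                   * octexp \<e>\<^sub>2 (- 2 * pi * f $ 2 * x $ 2)
                                   * octexp \<e>\<^sub>4 (- 2 * pi * f $ 3 * x $ 3))"

end

theory Submission
  imports Defs
begin

text \<open>
  The identity already holds between the integrands, and integration carries it over to the
  transforms because octonion multiplication is bilinear.

  Write \<open>w = z * exp (- \<i> * a)\<close>, where \<open>z\<close> is the value of the signal and \<open>a\<close>, \<open>b\<close>, \<open>c\<close> are
  the three phases. What has to be explained is how the exponentials of \<open>\<e>\<^sub>2\<close> and \<open>\<e>\<^sub>4\<close>, on the
  right, become complex exponentials next to \<open>w\<close>, on the left. For \<open>\<e>\<^sub>2\<close> this happens inside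
  the quaternions: since \<open>\<e>\<^sub>2 = - \<e>\<^sub>1 * \<e>\<^sub>3\<close>, the number \<open>octexp \<e>\<^sub>2 (- b)\<close> is a combination of
  \<open>exp (\<mp> \<i> * b)\<close> with the right factors \<open>1 \<mp> \<e>\<^sub>3\<close>. For \<open>\<e>\<^sub>4\<close> it is due to non-associativity:
  a quaternion \<open>y\<close> satisfies \<open>y * \<e>\<^sub>5 = (\<e>\<^sub>1 * y) * \<e>\<^sub>4\<close>, so \<open>\<e>\<^sub>1\<close> jumps over \<open>y\<close> to the far left,
  where it meets the complex number \<open>w\<close>, with which it commutes. All exponentials thus merge
  with \<open>z\<close> into the kernels of the classical transform at \<open>(f\<^sub>1, \<plusminus>f\<^sub>2, \<plusminus>f\<^sub>3)\<close>.
  The step for \<open>\<e>\<^sub>4\<close> is \<open>octexp_e4_split\<close>; the pointwise identity is \<open>oct_kernel_split\<close>.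
\<close>

definition quat_integrable :: "'a measure \<Rightarrow> ('a \<Rightarrow> quat) \<Rightarrow> bool" where
  "quat_integrable M g \<longleftrightarrow>
     integrable M (\<lambda>x. qre (g x)) \<and> integrable M (\<lambda>x. qim1 (g x)) \<and>
     integrable M (\<lambda>x. qim2 (g x)) \<and> integrable M (\<lambda>x. qim3 (g x))"

definition oct_integrable :: "'a measure \<Rightarrow> ('a \<Rightarrow> octonion) \<Rightarrow> bool" where
  "oct_integrable M g \<longleftrightarrow>
     quat_integrable M (\<lambda>x. oct_fst (g x)) \<and> quat_integrable M (\<lambda>x. oct_snd (g x))"

lemma quat_integrable_simps:
  assumes "quat_integrable M g"
  shows "quat_integrable M (\<lambda>x. g x * c)" "quat_integrable M (\<lambda>x. c * g x)"
    "quat_integrable M (\<lambda>x. r *\<^sub>R g x)"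
  using assms by (auto simp: quat_integrable_def)

lemma quat_integral_mult:
  assumes "quat_integrable M g"
  shows "quat_integral M (\<lambda>x. g x * c) = quat_integral M g * c"
    and "quat_integral M (\<lambda>x. c * g x) = c * quat_integral M g"
  using assms by (auto intro!: quat.expand simp: quat_integrable_def quat_integral_def)

lemma quat_integral_scaleR:
  "quat_integral M (\<lambda>x. r *\<^sub>R g x) = r *\<^sub>R quat_integral M g"
  by (auto intro!: quat.expand simp: quat_integral_def)

lemma quat_integral_add:
  assumes "quat_integrable M g" "quat_integrable M h"
  shows "quat_integrable M (\<lambda>x. g x + h x)"
    and "quat_integral M (\<lambda>x. g x + h x) = quat_integral M g + quat_integral M h"
  using assms by (auto intro!: quat.expand simp: quat_integrable_def quat_integral_def)

lemma quat_integral_diff: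
  assumes "quat_integrable M g" "quat_integrable M h"
  shows "quat_integrable M (\<lambda>x. g x - h x)"
    and "quat_integral M (\<lambda>x. g x - h x) = quat_integral M g - quat_integral M h"
  using assms by (auto intro!: quat.expand simp: quat_integrable_def quat_integral_def)

lemma oct_integral_add:
  assumes "oct_integrable M g" "oct_integrable M h"
  shows "oct_integrable M (\<lambda>x. g x + h x)"
    and "oct_integral M (\<lambda>x. g x + h x) = oct_integral M g + oct_integral M h"
  using assms
  by (auto intro!: octonion.expand simp: oct_integrable_def oct_integral_def quat_integral_add)

lemma oct_integral_scaleR:
  assumes "oct_integrable M g"
  shows "oct_integrable M (\<lambda>x. r *\<^sub>R g x)"
    and "oct_integral M (\<lambda>x. r *\<^sub>R g x) = r *\<^sub>R oct_integral M g"
  using assms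
  by (auto intro!: octonion.expand
      simp: oct_integrable_def oct_integral_def quat_integrable_simps quat_integral_scaleR)

lemma oct_integral_mult_left:
  assumes "oct_integrable M g"
  shows "oct_integrable M (\<lambda>x. g x * c)"
    and "oct_integral M (\<lambda>x. g x * c) = oct_integral M g * c"
  using assms
  by (auto intro!: octonion.expand
      simp: oct_integrable_def oct_integral_def quat_integrable_simps quat_integral_mult
        quat_integral_add quat_integral_diff)

lemma oct_integral_of_complex:
  assumes "integrable M g"
  shows "oct_integrable M (\<lambda>x. oct_of_complex (g x))"
    and "oct_integral M (\<lambda>x. oct_of_complex (g x)) = oct_of_complex (LINT x|M. g x)"
  using assms
  by (auto intro!: octonion.expand quat.expand
      simp: oct_integrable_def quat_integrable_def oct_integral_def quat_integral_def
        oct_of_complex_def \<e>\<^sub>1_def \<q>\<^sub>1_def)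

lemma oct_mult_add_left: "(a + b) * c = a * c + b * (c :: octonion)"
  by (auto intro!: octonion.expand simp: algebra_simps)

lemma oct_mult_scaleR_left: "(r *\<^sub>R a) * b = r *\<^sub>R (a * (b :: octonion))"
  by (auto intro!: octonion.expand simp: algebra_simps)

text \<open>
  All factors lie in the associative algebra of quaternions, where
  \<open>cis (- b) * (1 - \<e>\<^sub>3) + cis b * (1 + \<e>\<^sub>3) = 2 * cos b + 2 * sin b * \<e>\<^sub>1 * \<e>\<^sub>3\<close>
  and \<open>\<e>\<^sub>1 * \<e>\<^sub>3 = - \<e>\<^sub>2\<close>.
\<close>

lemma octexp_e2_split:
  "oct_of_complex w * octexp \<e>\<^sub>2 (- b) =
     (1/2) *\<^sub>R (oct_of_complex (w * cis (- b)) * (1 - \<e>\<^sub>3) + oct_of_complex (w * cis b) * (1 + \<e>\<^sub>3))"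
  by (rule octonion.expand)
     (auto intro!: quat.expand
       simp: oct_of_complex_def octexp_def octonion_unit_defs quat_unit_defs field_simps)

text \<open>
  Any quaternion \<open>v\<close> satisfies \<open>v * \<e>\<^sub>4 = (0, v)\<close> and \<open>v * \<e>\<^sub>5 = (0, \<q>\<^sub>1 * v)\<close>. Since \<open>\<q>\<^sub>1\<close> appears
  on the left of \<open>v = w * cis (\<mp> c) * y\<close>, the terms with \<open>\<e>\<^sub>5\<close> add up to
  \<open>\<q>\<^sub>1 * (cis c - cis (- c)) * w * y = - 2 * sin c * w * y\<close> in the second component, while the
  others add up to \<open>2 * cos c * w * y\<close> in the first one.
\<close>

lemma octexp_e4_split:
  assumes "oct_snd y = 0"
  shows "oct_of_complex w * y * octexp \<e>\<^sub>4 (- c) =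
     (1/2) *\<^sub>R (oct_of_complex (w * cis (- c)) * y * (1 - \<e>\<^sub>5)
             + oct_of_complex (w * cis c) * y * (1 + \<e>\<^sub>5))"
  by (rule octonion.expand)
     (auto intro!: quat.expand
       simp: assms oct_of_complex_def octexp_def octonion_unit_defs quat_unit_defs field_simps)

lemma oct_kernel_split:
  "oct_of_complex z * octexp \<e>\<^sub>1 (- a) * octexp \<e>\<^sub>2 (- b) * octexp \<e>\<^sub>4 (- c) =
     (1/4) *\<^sub>R (oct_of_complex (z * cis (- (a + b + c))) * (1 - \<e>\<^sub>3)
             + oct_of_complex (z * cis (- (a - b + c))) * (1 + \<e>\<^sub>3)) * (1 - \<e>\<^sub>5)
   + (1/4) *\<^sub>R (oct_of_complex (z * cis (- (a + b - c))) * (1 - \<e>\<^sub>3)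
             + oct_of_complex (z * cis (- (a - b - c))) * (1 + \<e>\<^sub>3)) * (1 + \<e>\<^sub>5)"
proof -
  define w where "w = z * cis (- a)"
  have w: "oct_of_complex z * octexp \<e>\<^sub>1 (- a) = oct_of_complex w"
    unfolding w_def oct_of_complex_hom(5) cis_conv_exp oct_of_complex_hom(6) ..
  have phases: "w * cis (- c) * cis (- b) = z * cis (- (a + b + c))"
      "w * cis (- c) * cis b = z * cis (- (a - b + c))"
      "w * cis c * cis (- b) = z * cis (- (a + b - c))"
      "w * cis c * cis b = z * cis (- (a - b - c))"
    by (simp_all add: w_def mult.assoc cis_mult algebra_simps)
  have "oct_of_complex z * octexp \<e>\<^sub>1 (- a) * octexp \<e>\<^sub>2 (- b) * octexp \<e>\<^sub>4 (- c) =
      (1/2) *\<^sub>R (oct_of_complex (w * cis (- c)) * octexp \<e>\<^sub>2 (- b) * (1 - \<e>\<^sub>5)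
              + oct_of_complex (w * cis c) * octexp \<e>\<^sub>2 (- b) * (1 + \<e>\<^sub>5))"
    unfolding w by (rule octexp_e4_split) (simp add: octexp_def \<e>\<^sub>2_def)
  then show ?thesis
    by (simp only: octexp_e2_split phases)
       (simp add: oct_mult_add_left oct_mult_scaleR_left scaleR_add_right)
qed

text \<open>The kernel of the Fourier transform is measurable and of modulus one.\<close>

lemma integrable_fourier_kernel:
  fixes u :: "real^3 \<Rightarrow> complex"
  assumes "integrable lebesgue u"
  shows "integrable lebesgue (\<lambda>x. u x * cis (- (2 * pi * (g1 * x $ 1 + g2 * x $ 2 + g3 * x $ 3))))"
proof (rule Bochner_Integration.integrable_bound[OF assms])
  have "continuous_on UNIV (\<lambda>x :: real^3. cis (- (2 * pi * (g1 * x $ 1 + g2 * x $ 2 + g3 * x $ 3))))"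
    by (intro continuous_intros)
  then have "(\<lambda>x :: real^3. cis (- (2 * pi * (g1 * x $ 1 + g2 * x $ 2 + g3 * x $ 3))))
      \<in> borel_measurable lebesgue"
    by (intro measurable_completion) (simp add: borel_measurable_continuous_onI)
  then show "(\<lambda>x. u x * cis (- (2 * pi * (g1 * x $ 1 + g2 * x $ 2 + g3 * x $ 3))))
      \<in> borel_measurable lebesgue"
    using assms by (intro borel_measurable_times) auto
qed (simp add: norm_mult)

lemma oct_integral_fourier_kernel:
  fixes u :: "real^3 \<Rightarrow> complex"
  assumes "integrable lebesgue u"
  defines "k \<equiv> \<lambda>g1 g2 g3 x. oct_of_complex (u x * cis (- (2 * pi * (g1 * x $ 1 + g2 * x $ 2 + g3 * x $ 3))))"
  shows "oct_integrable lebesgue (k g1 g2 g3)"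
    and "oct_integral lebesgue (k g1 g2 g3) = oct_of_complex (fourier u (vector [g1, g2, g3]))"
proof -
  have "exp (- \<i> * complex_of_real r) = cis (- r)" for r
    by (simp add: cis_conv_exp)
  then have "fourier u (vector [g1, g2, g3]) =
      (LINT x|lebesgue. u x * cis (- (2 * pi * (g1 * x $ 1 + g2 * x $ 2 + g3 * x $ 3))))"
    by (simp only: fourier_def vector_3)
  then show "oct_integrable lebesgue (k g1 g2 g3)"
    and "oct_integral lebesgue (k g1 g2 g3) = oct_of_complex (fourier u (vector [g1, g2, g3]))"
    using integrable_fourier_kernel[OF assms(1)]
    by (simp_all only: k_def oct_integral_of_complex)
qed

theorem theorem4:
  fixes u :: "real^3 \<Rightarrow> complex" and f1 f2 f3 :: real
  defines "U \<equiv> \<lambda>g1 g2 g3. oct_of_complex (fourier u (vector [g1, g2, g3]))"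
  assumes "integrable lebesgue u"
  shows "oct_fourier (\<lambda>x. oct_of_complex (u x)) (vector [f1, f2, f3]) =
      (1/4) *\<^sub>R (U f1 f2 f3 * (1 - \<e>\<^sub>3) + U f1 (- f2) f3 * (1 + \<e>\<^sub>3)) * (1 - \<e>\<^sub>5)
    + (1/4) *\<^sub>R (U f1 f2 (- f3) * (1 - \<e>\<^sub>3) + U f1 (- f2) (- f3) * (1 + \<e>\<^sub>3)) * (1 + \<e>\<^sub>5)"
proof -
  define k where "k = (\<lambda>g1 g2 g3 (x :: real^3).
    oct_of_complex (u x * cis (- (2 * pi * (g1 * x $ 1 + g2 * x $ 2 + g3 * x $ 3)))))"
  have k: "oct_integrable lebesgue (k g1 g2 g3)" "oct_integral lebesgue (k g1 g2 g3) = U g1 g2 g3"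
    for g1 g2 g3
    using oct_integral_fourier_kernel[OF assms(2)] by (simp_all add: k_def U_def)
  have "oct_of_complex (u x) * octexp \<e>\<^sub>1 (- 2 * pi * f1 * x $ 1)
          * octexp \<e>\<^sub>2 (- 2 * pi * f2 * x $ 2) * octexp \<e>\<^sub>4 (- 2 * pi * f3 * x $ 3) =
        (1/4) *\<^sub>R (k f1 f2 f3 x * (1 - \<e>\<^sub>3) + k f1 (- f2) f3 x * (1 + \<e>\<^sub>3)) * (1 - \<e>\<^sub>5)
      + (1/4) *\<^sub>R (k f1 f2 (- f3) x * (1 - \<e>\<^sub>3) + k f1 (- f2) (- f3) x * (1 + \<e>\<^sub>3)) * (1 + \<e>\<^sub>5)" for x
    using oct_kernel_split[of "u x" "2 * pi * f1 * x $ 1" "2 * pi * f2 * x $ 2" "2 * pi * f3 * x $ 3"]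
    by (simp add: k_def algebra_simps)
  then show ?thesis
    by (simp add: oct_fourier_def oct_integral_add oct_integral_scaleR oct_integral_mult_left k)
qed

end
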